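(* For every $\epsilon>0$ there is a constant $c$ such that every parenthesis matching $M$ on $n$ vertices satisfies $$r_<(M,K_3)\le c\,n^{1+\epsilon}.$$
   Context: An ordered graph on $[N]$ is a graph with vertex set $\{1,\dots,N\}$ equipped with the natural order. Given a red/blue coloring of the edges of the complete graph on $[N]$, a red (ordered) copy of an ordered graph $G$ on $[p]$ is a strictly increasing map $\varphi:[p]\to[N]$ such that $\varphi(u)\varphi(v)$ is red for every edge $uv$ of $G$. The ordered Ramsey number $r_<(G,K_3)$ is the smallest $N$ such that every red/blue coloring of the edges of the complete graph on $[N]$ contains either a red ordered copy of $G$ or a blue triangle. A parenthesis matching is an ordered perfect matching on $[n]$ in which no two edges cross: for any two edges $\{i,j\}$, $\{k,l\}$ with $i<j$, $k<l$, the intervals $[i,j]$ and $[k,l]$ are either disjoint or one is contained in the other (equivalently, it is the matching induced by a balanced parenthesis sequence, matched parentheses forming the edges). *)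

theory Defs
  imports Complex_Main
begin

text \<open>An ordered graph on [p] = {1..p} is given by its edge set E of pairs (u,v) with u < v.
  A red/blue colouring of K_N on [N] is a symmetric predicate red (true = red, false = blue).\<close>

definition red_ordered_copy :: "nat \<Rightarrow> (nat \<times> nat) set \<Rightarrow> nat \<Rightarrow> (nat \<Rightarrow> nat \<Rightarrow> bool) \<Rightarrow> bool" where
  "red_ordered_copy p E N red \<longleftrightarrow>
     (\<exists>\<phi>. strict_mono_on {1..p} \<phi> \<and> \<phi> ` {1..p} \<subseteq> {1..N} \<and>
          (\<forall>(u,v)\<in>E. red (\<phi> u) (\<phi> v)))"

definition blue_triangle :: "nat \<Rightarrow> (nat \<Rightarrow> nat \<Rightarrow> bool) \<Rightarrow> bool" where
  "blue_triangle N red \<longleftrightarrow>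
     (\<exists>a b c. 1 \<le> a \<and> a < b \<and> b < c \<and> c \<le> N \<and> \<not> red a b \<and> \<not> red a c \<and> \<not> red b c)"

definition ordered_ramsey_K3 :: "nat \<Rightarrow> (nat \<times> nat) set \<Rightarrow> nat" where
  "ordered_ramsey_K3 p E =
     (LEAST N. \<forall>red. (\<forall>x y. red x y = red y x) \<longrightarrow>
                   red_ordered_copy p E N red \<or> blue_triangle N red)"

definition parenthesis_matching :: "nat \<Rightarrow> (nat \<times> nat) set \<Rightarrow> bool" where
  "parenthesis_matching n M \<longleftrightarrow>
     (\<forall>(i,j)\<in>M. 1 \<le> i \<and> i < j \<and> j \<le> n) \<and>
     (\<forall>v\<in>{1..n}. \<exists>!e\<in>M. fst e = v \<or> snd e = v) \<and>
     (\<forall>(i,j)\<in>M. \<forall>(k,l)\<in>M.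
        {i..j} \<inter> {k..l} = {} \<or> {i..j} \<subseteq> {k..l} \<or> {k..l} \<subseteq> {i..j})"

end

theory Submission
  imports Defs
begin

text \<open>
  In a colouring without blue triangle, blue neighbourhoods are red cliques, so we may assume that
  every blue degree is less than the number \<open>m\<close> of vertices of the matching. Suppose all matchings on at
  most \<open>h\<close> vertices embed in every interval of length \<open>K\<close> times their size, and let \<open>m \<le> 2 h\<close>. Following
  the edges that enclose more than \<open>h\<close> vertices, the matching becomes a nested sequence of spine edges
  with matchings on at most \<open>h\<close> vertices hanging between them. Reserve \<open>K\<close> positions per vertex, and let
  the two ends of the interval built so far float by \<open>u, v < D\<close>. Passing from one spine edge to the
  next, a pair \<open>(u, v)\<close> becomes infeasible only because of a blue pair of vertices, and different
  infeasible pairs are charged to different blue pairs. Hence failure would force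
  \<open>D\<^sup>2 \<le> (K m + D) m\<close>, which is false for \<open>D = (\<surd>K + 1) m\<close>. So doubling \<open>h\<close> increases \<open>\<surd>K\<close>
  by at most 2, and the Ramsey number is in fact \<open>O(n (log n)\<^sup>2)\<close>.
\<close>

section \<open>Parenthesis forests\<close>

text \<open>\<open>Node l r\<close> is the balanced sequence \<open>(l)r\<close>.\<close>

datatype forest = Empty | Node forest forest

primrec weight :: "forest \<Rightarrow> nat" where
  "weight Empty = 0"
| "weight (Node l r) = weight l + weight r + 2"

primrec edges :: "forest \<Rightarrow> nat \<Rightarrow> (nat \<times> nat) set" where
  "edges Empty i = {}"
| "edges (Node l r) i =
     insert (i, i + 1 + weight l) (edges l (i + 1) \<union> edges r (i + 2 + weight l))"

primrec concat_forest :: "forest \<Rightarrow> forest \<Rightarrow> forest" where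
  "concat_forest Empty t = t"
| "concat_forest (Node l r) t = Node l (concat_forest r t)"

lemma weight_concat_forest [simp]: "weight (concat_forest s t) = weight s + weight t"
  by (induction s) auto

lemma edges_bounds: "(u, v) \<in> edges t i \<Longrightarrow> i \<le> u \<and> u < v \<and> v < i + weight t"
  by (induction t arbitrary: i) force+

text \<open>The edge at the first vertex \<open>i\<close> ends at some \<open>j\<close>, and
  noncrossing leaves every other edge either strictly between \<open>i\<close> and \<open>j\<close>
  or after \<open>j\<close>. Both groups are again noncrossing perfect matchings of intervals, so
  induction applies. The inclusion suffices, as a red copy of \<open>edges t i\<close> contains one
  of \<open>M\<close>.\<close>

lemma noncrossing_matching_imp_forest:
  assumes "\<And>u v. (u, v) \<in> M \<Longrightarrow> i \<le> u \<and> u < v \<and> v < i + n"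
    and "\<And>x. i \<le> x \<Longrightarrow> x < i + n \<Longrightarrow> \<exists>!e\<in>M. fst e = x \<or> snd e = x"
    and "\<And>u v u' v'. (u, v) \<in> M \<Longrightarrow> (u', v') \<in> M \<Longrightarrow>
      {u..v} \<inter> {u'..v'} = {} \<or> {u..v} \<subseteq> {u'..v'} \<or> {u'..v'} \<subseteq> {u..v}"
  shows "\<exists>t. weight t = n \<and> M \<subseteq> edges t i"
  using assms
proof (induction n arbitrary: i M rule: less_induct)
  case (less n)
  note bounds = less.prems(1) and uniq = less.prems(2) and nocross = less.prems(3)
  show ?case
  proof (cases "n = 0")
    case True
    then have "M = {}" using bounds by fastforce
    then show ?thesis using True by (intro exI[of _ Empty]) auto
  next
    case False
    have same: "e = e'" if "e \<in> M" "e' \<in> M" "fst e = x \<or> snd e = x" "fst e' = x \<or> snd e' = x" for e e' x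
    proof -
      have "i \<le> x \<and> x < i + n"
        using bounds[of "fst e" "snd e"] that by auto
      then show ?thesis using uniq[of x] that by blast
    qed
    obtain j where j: "(i, j) \<in> M"
    proof -
      obtain e where "e \<in> M" "fst e = i \<or> snd e = i"
        using uniq[of i] False by auto
      moreover have "snd e \<noteq> i"
        using bounds[of "fst e" "snd e"] \<open>e \<in> M\<close> by auto
      ultimately show ?thesis using that[of "snd e"] by (cases e) auto
    qed
    have ij: "i < j" "j < i + n" using bounds[OF j] by auto
    define L where "L = {(u, v) \<in> M. i < u \<and> v < j}"
    define R where "R = {(u, v) \<in> M. j < u}"
    \<comment> \<open>Another edge shares no endpoint with \<open>(i, j)\<close>. If it starts
      before \<open>j\<close>, the two intervals meet and \<open>i\<close> lies only in
      \<open>{i..j}\<close>, so \<open>{u..v}\<close> must be the inner one.\<close>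
    have split: "(u, v) = (i, j) \<or> (i < u \<and> v < j) \<or> j < u" if uv: "(u, v) \<in> M" for u v
    proof (cases "(u, v) = (i, j)")
      case False
      have apart: "u \<noteq> x \<and> v \<noteq> x" if "i = x \<or> j = x" for x
        using same[OF uv j _ , of x] False that by (metis fst_conv snd_conv)
      have "u \<noteq> i" "v \<noteq> j" "u \<noteq> j"
        by (simp_all add: apart)
      have "i < u" "u < v" using bounds[OF uv] \<open>u \<noteq> i\<close> by auto
      have "v < j" if "u \<le> j"
      proof -
        have "u \<in> {u..v} \<inter> {i..j}" "i \<notin> {u..v}"
          using that \<open>i < u\<close> \<open>u < v\<close> by auto
        moreover have "i \<in> {i..j}" using ij by simp
        ultimately have "{u..v} \<subseteq> {i..j}" using nocross[OF uv j] by blast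
        then show ?thesis using \<open>u < v\<close> \<open>v \<noteq> j\<close> by simp
      qed
      then show ?thesis using \<open>i < u\<close> \<open>u \<noteq> j\<close> by linarith
    qed simp
    have "\<exists>l. weight l = j - i - 1 \<and> L \<subseteq> edges l (i + 1)"
    proof (rule less.IH)
      show "j - i - 1 < n" using ij by linarith
      show "i + 1 \<le> u \<and> u < v \<and> v < i + 1 + (j - i - 1)" if "(u, v) \<in> L" for u v
        using that bounds[of u v] ij by (auto simp: L_def)
      show "\<exists>!e\<in>L. fst e = x \<or> snd e = x" if "i + 1 \<le> x" "x < i + 1 + (j - i - 1)" for x
      proof -
        have "i \<le> x" "x < i + n" using that ij by auto
        then obtain e where e: "e \<in> M" "fst e = x \<or> snd e = x"
          using uniq by blast
        then have "e \<in> L"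
          using split[of "fst e" "snd e"] bounds[of "fst e" "snd e"] that ij
          by (auto simp: L_def)
        moreover have "L \<subseteq> M" by (auto simp: L_def)
        ultimately show ?thesis using e same by blast
      qed
      show "{u..v} \<inter> {u'..v'} = {} \<or> {u..v} \<subseteq> {u'..v'} \<or> {u'..v'} \<subseteq> {u..v}"
        if "(u, v) \<in> L" "(u', v') \<in> L" for u v u' v'
        using that by (intro nocross) (auto simp: L_def)
    qed
    then obtain l where l: "weight l = j - i - 1" "L \<subseteq> edges l (i + 1)" by blast
    have "\<exists>r. weight r = i + n - (j + 1) \<and> R \<subseteq> edges r (j + 1)"
    proof (rule less.IH)
      show "i + n - (j + 1) < n" using ij by linarith
      show "j + 1 \<le> u \<and> u < v \<and> v < j + 1 + (i + n - (j + 1))" if "(u, v) \<in> R" for u v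
        using that bounds[of u v] ij by (auto simp: R_def)
      show "\<exists>!e\<in>R. fst e = x \<or> snd e = x" if "j + 1 \<le> x" "x < j + 1 + (i + n - (j + 1))" for x
      proof -
        have "i \<le> x" "x < i + n" using that ij by auto
        then obtain e where e: "e \<in> M" "fst e = x \<or> snd e = x"
          using uniq by blast
        then have "e \<in> R"
          using split[of "fst e" "snd e"] bounds[of "fst e" "snd e"] that ij
          by (auto simp: R_def)
        moreover have "R \<subseteq> M" by (auto simp: R_def)
        ultimately show ?thesis using e same by blast
      qed
      show "{u..v} \<inter> {u'..v'} = {} \<or> {u..v} \<subseteq> {u'..v'} \<or> {u'..v'} \<subseteq> {u..v}"
        if "(u, v) \<in> R" "(u', v') \<in> R" for u v u' v'
        using that by (intro nocross) (auto simp: R_def)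
    qed
    then obtain r where r: "weight r = i + n - (j + 1)" "R \<subseteq> edges r (j + 1)" by blast
    have "weight (Node l r) = n" using l r ij by simp
    moreover have "i + 1 + weight l = j" "i + 2 + weight l = j + 1" using l ij by auto
    then have "edges (Node l r) i = insert (i, j) (edges l (i + 1) \<union> edges r (j + 1))"
      by simp
    then have "M \<subseteq> edges (Node l r) i"
      using l r split by (fastforce simp: L_def R_def)
    ultimately show ?thesis by blast
  qed
qed

section \<open>Red copies in intervals\<close>

text \<open>A red copy of the forest in the half-open interval \<open>{a..<b}\<close>. Positions are integers so that
  intervals can be extended to the left without truncation.\<close>

primrec embeds :: "(int \<Rightarrow> int \<Rightarrow> bool) \<Rightarrow> forest \<Rightarrow> int \<Rightarrow> int \<Rightarrow> bool" where
  "embeds red Empty a b \<longleftrightarrow> a \<le> b"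
| "embeds red (Node l r) a b \<longleftrightarrow>
     (\<exists>x y. a \<le> x \<and> red x y \<and> embeds red l (x + 1) y \<and> embeds red r (y + 1) b)"

lemma embeds_imp_le: "embeds red t a b \<Longrightarrow> a \<le> b"
  by (induction t arbitrary: a b) force+

lemma embeds_mono: "embeds red t a b \<Longrightarrow> a' \<le> a \<Longrightarrow> b \<le> b' \<Longrightarrow> embeds red t a' b'"
proof (induction t arbitrary: a b a' b')
  case (Node l r)
  then obtain x y where "a \<le> x" "red x y" "embeds red l (x + 1) y" "embeds red r (y + 1) b"
    by auto
  moreover have "embeds red r (y + 1) b'"
    using Node.IH(2) calculation Node.prems by blast
  moreover have "a' \<le> x" using calculation Node.prems by linarith
  ultimately show ?case unfolding embeds.simps by blast
qed auto

lemma embeds_concat_forest: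
  "embeds red s a c \<Longrightarrow> embeds red t c b \<Longrightarrow> embeds red (concat_forest s t) a b"
proof (induction s arbitrary: a)
  case Empty
  then show ?case by (auto intro: embeds_mono)
qed fastforce

text \<open>Used contrapositively, together with \<open>embeds_Node_inner\<close>: an interval with
  no room for the inner part of a spine has none for a forest enclosing that part.\<close>

lemma embeds_concat_forest_right: "embeds red (concat_forest s t) a b \<Longrightarrow> embeds red t a b"
proof (induction s arbitrary: a)
  case (Node l r)
  then obtain x y where xy: "a \<le> x" "embeds red l (x + 1) y" "embeds red (concat_forest r t) (y + 1) b"
    by auto
  have "embeds red t (y + 1) b" using Node.IH xy by blast
  then show ?case using xy embeds_imp_le[OF xy(2)] by (auto intro: embeds_mono)
qed auto

lemma embeds_Node_inner: "embeds red (Node t r) a b \<Longrightarrow> embeds red t a b"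
proof -
  assume "embeds red (Node t r) a b"
  then obtain x y where "a \<le> x" "embeds red t (x + 1) y" "embeds red r (y + 1) b"
    by auto
  moreover from this have "y + 1 \<le> b" by (blast dest: embeds_imp_le)
  ultimately show ?thesis by (auto intro: embeds_mono)
qed

lemma embeds_red_sequence:
  assumes "\<And>k k'. i \<le> k \<Longrightarrow> k < k' \<Longrightarrow> k' < i + weight t \<Longrightarrow> g k < g k' \<and> red (g k) (g k')"
    and "\<And>k. i \<le> k \<Longrightarrow> k < i + weight t \<Longrightarrow> a \<le> g k \<and> g k < b"
    and "a \<le> b"
  shows "embeds red t a b"
  using assms
proof (induction t arbitrary: i a b)
  case (Node l r)
  let ?j = "i + 1 + weight l"
  have "embeds red l (g i + 1) (g ?j)"
  proof (rule Node.IH(1)[of "i + 1"])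
    show "g i + 1 \<le> g k \<and> g k < g ?j" if "i + 1 \<le> k" "k < i + 1 + weight l" for k
      using Node.prems(1)[of i k] Node.prems(1)[of k ?j] that by auto
    show "g i + 1 \<le> g ?j" using Node.prems(1)[of i ?j] by auto
  qed (use Node.prems(1) in auto)
  moreover have "embeds red r (g ?j + 1) b"
  proof (rule Node.IH(2)[of "?j + 1"])
    show "g ?j + 1 \<le> g k \<and> g k < b" if "?j + 1 \<le> k" "k < ?j + 1 + weight r" for k
      using Node.prems(1)[of ?j k] Node.prems(2)[of k] that by auto
    show "g ?j + 1 \<le> b" using Node.prems(2)[of ?j] by auto
  qed (use Node.prems(1) in auto)
  moreover have "a \<le> g i" "red (g i) (g ?j)"
    using Node.prems(1)[of i ?j] Node.prems(2)[of i] by auto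
  ultimately show ?case by auto
qed auto

text \<open>Meant for blue neighbourhoods, which are red cliques when there is no blue triangle.
  Listing \<open>Q\<close> in increasing order gives the red sequence.\<close>

lemma embeds_red_clique:
  assumes "finite Q" "Q \<subseteq> {a..<b}" "weight t \<le> card Q" "a \<le> b"
    and clique: "\<And>x y. x \<in> Q \<Longrightarrow> y \<in> Q \<Longrightarrow> x < y \<Longrightarrow> red x y"
  shows "embeds red t a b"
proof (rule embeds_red_sequence[of 0 t "\<lambda>k. sorted_list_of_set Q ! k"])
  let ?xs = "sorted_list_of_set Q"
  have len: "length ?xs = card Q" by simp
  have mem: "?xs ! k \<in> Q" if "k < weight t" for k
    using nth_mem[of k ?xs] that assms by simp
  show "?xs ! k < ?xs ! k' \<and> red (?xs ! k) (?xs ! k')" if "0 \<le> k" "k < k'" "k' < 0 + weight t" for k k'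
  proof -
    have "?xs ! k < ?xs ! k'"
      using strict_sorted_list_of_set[of Q] that assms
      by (intro sorted_wrt_nth_less[of "(<)"]) auto
    then show ?thesis using clique mem that by auto
  qed
  show "a \<le> ?xs ! k \<and> ?xs ! k < b" if "0 \<le> k" "k < 0 + weight t" for k
    using mem[of k] that assms(2) by auto
qed (use assms in auto)

lemma embeds_imp_strict_mono_copy:
  "embeds red t a b \<Longrightarrow> \<exists>\<phi>. strict_mono_on {i..<i + weight t} \<phi> \<and>
     \<phi> ` {i..<i + weight t} \<subseteq> {a..<b} \<and> (\<forall>(u, v)\<in>edges t i. red (\<phi> u) (\<phi> v))"
proof (induction t arbitrary: a b i)
  case (Node l r)
  then obtain x y where xy: "a \<le> x" "red x y" and l: "embeds red l (x + 1) y"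
    and r: "embeds red r (y + 1) b" by auto
  let ?j = "i + 1 + weight l"
  obtain f where f: "strict_mono_on {i + 1..<?j} f"
      "f ` {i + 1..<?j} \<subseteq> {x + 1..<y}" "\<forall>(u, v)\<in>edges l (i + 1). red (f u) (f v)"
    using Node.IH(1)[OF l, of "i + 1"] by auto
  obtain g where g: "strict_mono_on {?j + 1..<?j + 1 + weight r} g"
      "g ` {?j + 1..<?j + 1 + weight r} \<subseteq> {y + 1..<b}"
      "\<forall>(u, v)\<in>edges r (?j + 1). red (g u) (g v)"
    using Node.IH(2)[OF r, of "?j + 1"] by auto
  define \<phi> where "\<phi> k = (if k = i then x else if k < ?j then f k else if k = ?j then y else g k)" for k
  have le: "x + 1 \<le> y" "y + 1 \<le> b" using l r by (auto dest: embeds_imp_le)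
  have fb: "x < f k \<and> f k < y" if "i < k" "k < ?j" for k
  proof -
    have "f k \<in> {x + 1..<y}" using f(2) that by (intro subsetD[OF f(2)] imageI) auto
    then show ?thesis by auto
  qed
  have gb: "y < g k \<and> g k < b" if "?j < k" "k < ?j + 1 + weight r" for k
  proof -
    have "g k \<in> {y + 1..<b}" using that by (intro subsetD[OF g(2)] imageI) auto
    then show ?thesis by auto
  qed
  have "\<phi> k < \<phi> k'" if "i \<le> k" "k < k'" "k' < i + weight (Node l r)" for k k'
  proof -
    have ff: "f k < f k'" if "i < k" "k' < ?j"
      using f(1) that \<open>k < k'\<close> by (auto simp: strict_mono_on_def)
    have gg: "g k < g k'" if "?j < k"
      using g(1) that \<open>k < k'\<close> \<open>k' < _\<close> by (auto simp: strict_mono_on_def)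
    show ?thesis
      using that le ff gg fb[of k] fb[of k'] gb[of k] gb[of k'] unfolding \<phi>_def
      by (auto split: if_splits)
  qed
  then have "strict_mono_on {i..<i + weight (Node l r)} \<phi>"
    by (auto simp: strict_mono_on_def)
  moreover have "\<phi> k \<in> {a..<b}" if "i \<le> k" "k < i + weight (Node l r)" for k
    using that le xy fb[of k] gb[of k] unfolding \<phi>_def by auto
  then have "\<phi> ` {i..<i + weight (Node l r)} \<subseteq> {a..<b}" by auto
  moreover have "red (\<phi> u) (\<phi> v)" if "(u, v) \<in> edges (Node l r) i" for u v
  proof -
    consider "u = i" "v = ?j" | "(u, v) \<in> edges l (i + 1)" | "(u, v) \<in> edges r (?j + 1)"
      using \<open>(u, v) \<in> _\<close> by auto
    then show ?thesis
    proof cases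
      case 1
      then show ?thesis using xy by (simp add: \<phi>_def)
    next
      case 2
      then have "red (f u) (f v)" using f(3) by auto
      then show ?thesis using edges_bounds[OF 2] by (auto simp: \<phi>_def)
    next
      case 3
      then have "red (g u) (g v)" using g(3) by auto
      then show ?thesis using edges_bounds[OF 3] by (auto simp: \<phi>_def)
    qed
  qed
  ultimately show ?case by blast
qed (auto simp: strict_mono_on_def)

section \<open>Spine decomposition\<close>

text \<open>Only top-level components are bounded, not their total; the \<open>+ 2\<close> counts
  the outer pair of a component.\<close>

primrec components_le :: "nat \<Rightarrow> forest \<Rightarrow> bool" where
  "components_le h Empty \<longleftrightarrow> True"
| "components_le h (Node l r) \<longleftrightarrow> weight l + 2 \<le> h \<and> components_le h r"

inductive spine :: "nat \<Rightarrow> forest \<Rightarrow> bool" for h where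
  core: "components_le h t \<Longrightarrow> spine h t"
| enclose: "spine h t \<Longrightarrow> weight l \<le> h \<Longrightarrow> weight r \<le> h \<Longrightarrow> spine h (concat_forest l (Node t r))"

lemma not_components_leE:
  assumes "\<not> components_le h t"
  obtains l u r where "t = concat_forest l (Node u r)" "h < weight u + 2"
  using assms
proof (induction t arbitrary: thesis)
  case (Node v w)
  show ?case
  proof (cases "weight v + 2 \<le> h")
    case True
    then obtain l u r where "w = concat_forest l (Node u r)" "h < weight u + 2"
      using Node.IH(2) Node.prems by auto
    then show ?thesis using Node.prems(1)[of "Node v l"] by auto
  next
    case False
    then show ?thesis using Node.prems(1)[of Empty] by auto
  qed
qed simp

text \<open>A top-level component with more than \<open>h\<close> of the at most
  \<open>2 * h\<close> vertices leaves fewer than \<open>h\<close> for the two forests beside it.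
  Its outer pair is the next spine edge, and the argument recurses inside it.\<close>

lemma spine_if_weight_le: "weight t \<le> 2 * h \<Longrightarrow> spine h t"
proof (induction "weight t" arbitrary: t rule: less_induct)
  case less
  show ?case
  proof (cases "components_le h t")
    case False
    then obtain l u r where t: "t = concat_forest l (Node u r)" "h < weight u + 2"
      by (rule not_components_leE)
    have "spine h u" using t less by simp
    then show ?thesis using t less.prems by (auto intro: spine.enclose)
  qed (rule spine.core)
qed

section \<open>Charging infeasible shifts to blue pairs\<close>

definition linear_bound :: "(int \<Rightarrow> int \<Rightarrow> bool) \<Rightarrow> nat \<Rightarrow> nat \<Rightarrow> bool" where
  "linear_bound red h K \<longleftrightarrow>
     (\<forall>t a b. weight t \<le> h \<longrightarrow> a + int (K * weight t) \<le> b \<longrightarrow> embeds red t a b)"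

text \<open>The components go one after another into consecutive blocks of \<open>K\<close>
  positions per vertex.\<close>

lemma embeds_if_components_le:
  assumes "linear_bound red h K"
  shows "components_le h t \<Longrightarrow> a + int (K * weight t) \<le> b \<Longrightarrow> embeds red t a b"
proof (induction t arbitrary: a)
  case (Node l r)
  let ?c = "a + int (K * (weight l + 2))"
  have "embeds red (Node l Empty) a ?c"
    using assms Node.prems(1) unfolding linear_bound_def
    by (simp del: embeds.simps of_nat_mult of_nat_add)
  moreover have "embeds red r ?c b"
    using Node by (simp add: algebra_simps)
  ultimately have "embeds red (concat_forest (Node l Empty) r) a b"
    by (rule embeds_concat_forest)
  then show ?case by simp
qed simp

text \<open>Induction along the spine from the inside out. \<open>Z\<close> collects the charged
  blue pairs. Its last condition, that \<open>t\<close> does not fit strictly between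
  \<open>x\<close> and \<open>y\<close>, is the invariant that keeps pairs charged at different
  stages distinct.\<close>

lemma card_infeasible_shifts_le:
  assumes bound: "linear_bound red h K" and "K > 0"
  shows "spine h t \<Longrightarrow> q = p + int (K * weight t) \<Longrightarrow>
    \<exists>Z. finite Z \<and>
      card {(u, v). u \<in> {0..<D} \<and> v \<in> {0..<D} \<and> \<not> embeds red t (p - u) (q + v)} \<le> card Z \<and>
      (\<forall>(x, y)\<in>Z. p - D \<le> x \<and> x < q \<and> x < y \<and> y < q + D \<and> \<not> red x y \<and>
         \<not> embeds red t (x + 1) y)"
proof (induction arbitrary: p q rule: spine.induct)
  case (core t)
  have "embeds red t (p - u) (q + v)" if "u \<in> {0..<D}" "v \<in> {0..<D}" for u v
    using core that by (intro embeds_if_components_le[OF bound]) auto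
  then have "{(u, v). u \<in> {0..<D} \<and> v \<in> {0..<D} \<and> \<not> embeds red t (p - u) (q + v)} = {}"
    by auto
  then show ?case by (intro exI[of _ "{}"]) (simp only: card.empty, simp)
next
  case (enclose t l r p' q')
  \<comment> \<open>Inside the block of the enclosing forest, \<open>l\<close> gets its
    \<open>K * weight l\<close> positions and the left end of the spine edge gets another
    \<open>K\<close>; the inner block starts at \<open>p\<close> and ends before
    \<open>q\<close>.\<close>
  define p where "p = p' + int (K * weight l) + int K"
  define q where "q = p + int (K * weight t)"
  let ?t' = "concat_forest l (Node t r)"
  let ?B = "{(u, v). u \<in> {0..<D} \<and> v \<in> {0..<D} \<and> \<not> embeds red t (p - u) (q + v)}"
  let ?B' = "{(u, v). u \<in> {0..<D} \<and> v \<in> {0..<D} \<and> \<not> embeds red ?t' (p' - u) (q' + v)}"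
  have q': "q' = q + int K + int (K * weight r)"
    using enclose.prems by (simp add: q_def p_def algebra_simps)
  have pq: "p' < p" "p \<le> q" "q < q'"
    using \<open>K > 0\<close> q' by (simp_all add: p_def q_def pos_add_strict add_nonneg_pos add_pos_nonneg)
  obtain Z where Z: "finite Z" "card ?B \<le> card Z"
    and Zb: "\<And>x y. (x, y) \<in> Z \<Longrightarrow> p - D \<le> x \<and> x < q \<and> x < y \<and> y < q + D \<and> \<not> red x y \<and>
         \<not> embeds red t (x + 1) y"
    using enclose.IH[OF q_def] by blast
  \<comment> \<open>The positions directly before and directly after the shifted half-open interval
    of \<open>t\<close>. Were this pair red, it could serve as the spine edge, with room for
    \<open>l\<close> before it and for \<open>r\<close> behind it.\<close>
  let ?cell = "\<lambda>(u, v). (p - 1 - u, q + v)"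
  let ?New = "?cell ` (?B' - ?B)"
  have fin: "finite ?B'" "finite ?B"
    by (rule finite_subset[of _ "{0..<D} \<times> {0..<D}"]; auto)+
  have new: "p' - D \<le> x \<and> x < q' \<and> x < y \<and> y < q' + D \<and> \<not> red x y \<and>
       \<not> embeds red ?t' (x + 1) y \<and> embeds red t (x + 1) y" if xy: "(x, y) \<in> ?New" for x y
  proof -
    obtain u v where uv: "0 \<le> u" "u < D" "0 \<le> v" "v < D" "x = p - 1 - u" "y = q + v"
      and ok: "embeds red t (p - u) (q + v)" and nok: "\<not> embeds red ?t' (p' - u) (q' + v)"
      using xy by auto
    have "\<not> red x y"
    proof
      assume "red x y"
      have "embeds red l (p' - u) x"
        using bound enclose.hyps \<open>K > 0\<close> uv unfolding linear_bound_def
        by (simp add: p_def)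
      moreover have "embeds red r (y + 1) (q' + v)"
        using bound enclose.hyps \<open>K > 0\<close> uv unfolding linear_bound_def
        by (simp add: q')
      then have "embeds red (Node t r) x (q' + v)"
        unfolding embeds.simps using \<open>red x y\<close> ok uv
        by (intro exI[of _ x] exI[of _ y]) simp
      ultimately show False using nok embeds_concat_forest by blast
    qed
    \<comment> \<open>The gap between \<open>x\<close> and \<open>y\<close> lies inside the
      infeasible interval, which re-establishes the invariant for \<open>?t'\<close>.\<close>
    moreover have "\<not> embeds red ?t' (x + 1) y"
      using nok uv pq embeds_mono[of red ?t' "x + 1" y "p' - u" "q' + v"] by auto
    ultimately show ?thesis using uv pq ok by auto
  qed
  have "inj_on ?cell (?B' - ?B)" by (auto simp: inj_on_def)
  then have "card ?New = card (?B' - ?B)" by (rule card_image)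
  \<comment> \<open>In a new pair \<open>t\<close> fits between the two positions; in a pair of
    \<open>Z\<close> it does not.\<close>
  moreover have "z \<notin> Z" if "z \<in> ?New" for z
    using new[of "fst z" "snd z"] Zb[of "fst z" "snd z"] that unfolding prod.collapse by blast
  then have "?New \<inter> Z = {}" by blast
  ultimately have card: "card (?New \<union> Z) = card (?B' - ?B) + card Z"
    using fin Z(1) by (subst card_Un_disjoint) auto
  have "card ?B' \<le> card ((?B' - ?B) \<union> ?B)" using fin by (intro card_mono) auto
  also have "\<dots> \<le> card (?B' - ?B) + card ?B" by (rule card_Un_le)
  finally have "card ?B' \<le> card (?New \<union> Z)" using card Z(2) by linarith
  moreover have "p' - D \<le> x \<and> x < q' \<and> x < y \<and> y < q' + D \<and> \<not> red x y \<and>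
         \<not> embeds red ?t' (x + 1) y" if "(x, y) \<in> ?New \<union> Z" for x y
  proof (cases "(x, y) \<in> Z")
    case True
    have "\<not> embeds red ?t' (x + 1) y"
      using Zb[OF True] embeds_concat_forest_right embeds_Node_inner by blast
    then show ?thesis using Zb[OF True] pq by auto
  next
    case False
    then have "(x, y) \<in> ?New" using that by blast
    from new[OF this] show ?thesis by blast
  qed
  moreover have "finite (?New \<union> Z)" using fin Z(1) by simp
  ultimately show ?case by blast
qed

section \<open>Doubling the size\<close>

locale blue_triangle_free =
  fixes red :: "int \<Rightarrow> int \<Rightarrow> bool"
  assumes no_blue_triangle: "x < y \<Longrightarrow> y < z \<Longrightarrow> red x y \<or> red x z \<or> red y z"
begin

text \<open>The extra \<open>2 * s\<close> positions per vertex let each end of the middle block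
  float by \<open>D = s * weight t\<close> without leaving the given interval. If \<open>t\<close>
  does not embed, all \<open>D * D\<close> shifts are infeasible, and \<open>s\<close> is chosen
  large enough that there are too few blue pairs to charge.\<close>

lemma linear_bound_double:
  assumes bound: "linear_bound red h K" and "K > 0" and s: "K + s < s * s"
  shows "linear_bound red (2 * h) (K + 2 * s)"
  unfolding linear_bound_def
proof (intro allI impI, rule ccontr)
  fix t a b
  assume w: "weight t \<le> 2 * h" and ab: "a + int ((K + 2 * s) * weight t) \<le> b"
    and not: "\<not> embeds red t a b"
  let ?m = "weight t"
  define D where "D = int (s * ?m)"
  define p where "p = a + D"
  define q where "q = p + int (K * ?m)"
  have "a \<le> b" using ab by (smt (verit) of_nat_0_le_iff)
  have "?m \<noteq> 0" using not \<open>a \<le> b\<close> by (cases t) auto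
  have qb: "q + D \<le> b" using ab by (simp add: q_def p_def D_def algebra_simps)
  obtain Z where Z: "finite Z"
    "card {(u, v). u \<in> {0..<D} \<and> v \<in> {0..<D} \<and> \<not> embeds red t (p - u) (q + v)} \<le> card Z"
    and Zb: "\<And>x y. (x, y) \<in> Z \<Longrightarrow> p - D \<le> x \<and> x < q \<and> x < y \<and> y < q + D \<and> \<not> red x y"
    using card_infeasible_shifts_le[OF bound \<open>K > 0\<close> spine_if_weight_le[OF w] q_def, of D] by blast
  have "\<not> embeds red t (p - u) (q + v)" if "u \<in> {0..<D}" "v \<in> {0..<D}" for u v
    using not embeds_mono[of red t "p - u" "q + v" a b] that qb by (auto simp: p_def)
  then have "{(u, v). u \<in> {0..<D} \<and> v \<in> {0..<D} \<and> \<not> embeds red t (p - u) (q + v)} =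
      {0..<D} \<times> {0..<D}" by auto
  then have lower: "(s * ?m) * (s * ?m) \<le> card Z"
    using Z(2) by (simp add: D_def card_cartesian_product nat_mult_distrib)
  \<comment> \<open>The blue neighbours to the right of \<open>x\<close> form a red clique; more
    than \<open>?m\<close> of them would contain \<open>t\<close>.\<close>
  have nbrs: "card {y. x < y \<and> y < b \<and> \<not> red x y} \<le> ?m" if "a \<le> x" for x
  proof (rule ccontr)
    assume "\<not> ?thesis"
    moreover have "finite {y. x < y \<and> y < b \<and> \<not> red x y}"
      by (rule finite_subset[of _ "{x..b}"]) auto
    moreover have "red y z" if "x < y" "\<not> red x y" "\<not> red x z" "y < z" for y z
      using no_blue_triangle[of x y z] that by blast
    ultimately have "embeds red t a b"
      using \<open>a \<le> x\<close> \<open>a \<le> b\<close>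
      by (intro embeds_red_clique[of "{y. x < y \<and> y < b \<and> \<not> red x y}"]) auto
    then show False using not by blast
  qed
  \<comment> \<open>Count the pairs of \<open>Z\<close> by their left ends, which lie in
    \<open>{a..<q}\<close> since \<open>p - D = a\<close>.\<close>
  have "Z \<subseteq> (SIGMA x:{a..<q}. {y. x < y \<and> y < b \<and> \<not> red x y})"
    using Zb qb by (force simp: p_def)
  moreover have finS: "finite {y. x < y \<and> y < b \<and> \<not> red x y}" for x
    by (rule finite_subset[of _ "{x..b}"]) auto
  ultimately have "card Z \<le> card (SIGMA x:{a..<q}. {y. x < y \<and> y < b \<and> \<not> red x y})"
    by (intro card_mono finite_SigmaI) auto
  also have "\<dots> = (\<Sum>x\<in>{a..<q}. card {y. x < y \<and> y < b \<and> \<not> red x y})"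
    using finS by (intro card_SigmaI) auto
  also have "\<dots> \<le> (\<Sum>x\<in>{a..<q}. ?m)" using nbrs by (intro sum_mono) auto
  also have "\<dots> = nat (q - a) * ?m" by simp
  also have "q - a = int ((K + s) * ?m)" by (simp add: q_def p_def D_def algebra_simps)
  finally have "card Z \<le> (K + s) * ?m * ?m" by (simp only: nat_int)
  then have "(s * s) * (?m * ?m) \<le> (K + s) * (?m * ?m)"
    using lower by (simp add: algebra_simps)
  then show False using s \<open>?m \<noteq> 0\<close> by simp
qed

lemma linear_bound_mono: "linear_bound red h K \<Longrightarrow> K \<le> K' \<Longrightarrow> linear_bound red h K'"
  unfolding linear_bound_def
proof (intro allI impI)
  fix t a b
  assume "\<forall>t a b. weight t \<le> h \<longrightarrow> a + int (K * weight t) \<le> b \<longrightarrow> embeds red t a b"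
    and "weight t \<le> h" "a + int (K' * weight t) \<le> b" "K \<le> K'"
  moreover from \<open>K \<le> K'\<close> have "int (K * weight t) \<le> int (K' * weight t)"
    by (simp only: of_nat_le_iff mult_le_mono1)
  ultimately show "embeds red t a b" by simp
qed

lemma linear_bound_power2: "linear_bound red (2 ^ j) ((2 * j + 1)\<^sup>2)"
proof (induction j)
  case 0
  have "t = Empty" if "weight t \<le> 1" for t using that by (cases t) auto
  then show ?case by (force simp: linear_bound_def)
next
  case (Suc j)
  let ?k = "2 * j + 1"
  \<comment> \<open>With \<open>K = ?k^2\<close> the choice \<open>s = ?k + 1\<close> works:
    \<open>K + s = ?k^2 + ?k + 1\<close> is below \<open>(?k + 1)^2\<close>, and
    \<open>K + 2 * s = ?k^2 + 2 * ?k + 2\<close> is at most \<open>(?k + 2)^2\<close>, the next odd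
    square.\<close>
  have "linear_bound red (2 * 2 ^ j) (?k\<^sup>2 + 2 * (?k + 1))"
    using Suc by (rule linear_bound_double) (auto simp: power2_eq_square)
  then have "linear_bound red (2 ^ Suc j) (?k\<^sup>2 + 2 * (?k + 1))" by simp
  then show ?case
    by (rule linear_bound_mono) (simp add: power2_eq_square)
qed

end

section \<open>The Ramsey bound\<close>

lemma parenthesis_matching_imp_forest:
  assumes "parenthesis_matching n M"
  obtains t where "weight t = n" "M \<subseteq> edges t 1"
proof -
  have "\<exists>t. weight t = n \<and> M \<subseteq> edges t 1"
  proof (rule noncrossing_matching_imp_forest)
    show "1 \<le> u \<and> u < v \<and> v < 1 + n" if "(u, v) \<in> M" for u v
      using assms that unfolding parenthesis_matching_def by fastforce
    show "\<exists>!e\<in>M. fst e = x \<or> snd e = x" if "1 \<le> x" "x < 1 + n" for x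
      using assms that unfolding parenthesis_matching_def by simp
    show "{u..v} \<inter> {u'..v'} = {} \<or> {u..v} \<subseteq> {u'..v'} \<or> {u'..v'} \<subseteq> {u..v}"
      if "(u, v) \<in> M" "(u', v') \<in> M" for u v u' v'
      using assms that unfolding parenthesis_matching_def by blast
  qed
  then show ?thesis using that by blast
qed

lemma ordered_ramsey_K3_le:
  assumes M: "parenthesis_matching n M" and n: "n \<le> 2 ^ j"
  shows "ordered_ramsey_K3 n M \<le> (2 * j + 1)\<^sup>2 * n"
proof -
  define N where "N = (2 * j + 1)\<^sup>2 * n"
  obtain t where t: "weight t = n" "M \<subseteq> edges t 1"
    using parenthesis_matching_imp_forest[OF M] .
  have "red_ordered_copy n M N red" if no_tri: "\<not> blue_triangle N red" for red
  proof -
    \<comment> \<open>Everything outside \<open>{1..N}\<close> is coloured red to get a colouring of the integers.\<close>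
    define red' where "red' x y \<longleftrightarrow> (1 \<le> x \<and> y \<le> int N \<longrightarrow> red (nat x) (nat y))" for x y :: int
    interpret blue_triangle_free red'
    proof
      fix x y z :: int
      assume "x < y" "y < z"
      \<comment> \<open>If all three pairs were blue, \<open>x y\<close> would force
        \<open>1 <= x\<close> and \<open>x z\<close> would force \<open>z <= N\<close>, so the
        triangle would be one of \<open>red\<close> inside \<open>{1..N}\<close>.\<close>
      then show "red' x y \<or> red' x z \<or> red' y z"
        using no_tri[unfolded blue_triangle_def, simplified, rule_format, of "nat x" "nat y" "nat z"]
        unfolding red'_def by auto
    qed
    have "embeds red' t 1 (1 + int N)"
      using linear_bound_power2[of j] t(1) n unfolding linear_bound_def N_def by auto
    from embeds_imp_strict_mono_copy[OF this, of 1] obtain f where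
      mono: "strict_mono_on {1..n} f" and range: "f ` {1..n} \<subseteq> {1..<1 + int N}"
      and red': "\<forall>(u, v)\<in>edges t 1. red' (f u) (f v)"
      using t(1) by (auto simp: atLeastLessThanSuc_atLeastAtMost)
    have range': "1 \<le> f k \<and> f k \<le> int N" if "k \<in> {1..n}" for k
      using range that by force
    have "strict_mono_on {1..n} (nat \<circ> f)"
    proof (rule strict_mono_onI)
      fix k k'
      assume k: "k \<in> {1..n}" "k' \<in> {1..n}" "k < k'"
      have "f k < f k'" using strict_mono_onD[OF mono k] .
      then show "(nat \<circ> f) k < (nat \<circ> f) k'" using range'[OF k(1)] by simp
    qed
    moreover have "(nat \<circ> f) ` {1..n} \<subseteq> {1..N}" using range' by fastforce
    moreover have "red ((nat \<circ> f) u) ((nat \<circ> f) v)" if "(u, v) \<in> M" for u v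
    proof -
      have uv: "(u, v) \<in> edges t 1" using t(2) that by blast
      have "u \<in> {1..n}" "v \<in> {1..n}" using edges_bounds[OF uv] t(1) by auto
      moreover have "red' (f u) (f v)" using red' uv by auto
      ultimately show ?thesis using range' by (auto simp: red'_def)
    qed
    ultimately show ?thesis unfolding red_ordered_copy_def by blast
  qed
  then show ?thesis
    unfolding ordered_ramsey_K3_def N_def by (intro Least_le) blast
qed

theorem theorem2p8:
  "\<forall>\<epsilon>::real. \<epsilon> > 0 \<longrightarrow> (\<exists>c::real. \<forall>n M. parenthesis_matching n M \<longrightarrow>
      real (ordered_ramsey_K3 n M) \<le> c * real n powr (1 + \<epsilon>))"
proof (intro allI impI)
  fix \<epsilon> :: real
  assume "\<epsilon> > 0"
  \<comment> \<open>With \<open>j = i + 1\<close> the root of the factor is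
    \<open>2 * i + 3\<close>. Below, \<open>2 * i\<close> is at most \<open>8 / \<epsilon>\<close>
    times \<open>?x\<close>, and \<open>3\<close> is at most \<open>3 * ?x\<close>; squaring
    \<open>?x\<close> then yields the power \<open>\<epsilon>\<close> of \<open>n\<close>.\<close>
  let ?C = "8 / \<epsilon> + 3"
  have "real (ordered_ramsey_K3 n M) \<le> ?C\<^sup>2 * real n powr (1 + \<epsilon>)"
    if M: "parenthesis_matching n M" for n M
  proof (cases "n = 0")
    case True
    then show ?thesis using ordered_ramsey_K3_le[OF M, of 0] by simp
  next
    case False
    then obtain i where i: "2 ^ i \<le> n" "n < 2 ^ (i + 1)"
      using ex_power_ivl1[of 2 n] by auto
    let ?x = "real n powr (\<epsilon> / 2)"
    have "?x \<ge> 1" using False \<open>\<epsilon> > 0\<close> by (simp add: ge_one_powr_ge_zero)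
    \<comment> \<open>The bound \<open>ln y <= y - 1\<close> at \<open>y = 1 / 2\<close> gives
      \<open>ln 2 >= 1 / 2\<close>.\<close>
    have "real i * (1 / 2) \<le> real i * ln 2"
      using ln_le_minus_one[of "1 / 2"] by (intro mult_left_mono) (auto simp: ln_div)
    also have "\<dots> = ln (2 ^ i)" by (simp add: ln_realpow)
    also have "\<dots> \<le> ln (real n)"
    proof -
      have "(2::real) ^ i \<le> real n" using i(1) by (metis of_nat_le_iff of_nat_numeral of_nat_power)
      then show ?thesis using False by simp
    qed
    also have "\<dots> \<le> ?x / (\<epsilon> / 2)"
      using False \<open>\<epsilon> > 0\<close> by (intro ln_powr_bound) auto
    finally have "2 * real i \<le> 8 / \<epsilon> * ?x" by simp
    then have "real (2 * (i + 1) + 1) \<le> ?C * ?x"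
      using \<open>?x \<ge> 1\<close> by (simp add: algebra_simps)
    then have "(real (2 * (i + 1) + 1))\<^sup>2 \<le> (?C * ?x)\<^sup>2"
      by (intro power_mono) auto
    also have "\<dots> = ?C\<^sup>2 * real n powr \<epsilon>"
      using False by (simp add: power_mult_distrib power2_eq_square flip: powr_add)
    finally have sq: "(real (2 * (i + 1) + 1))\<^sup>2 \<le> ?C\<^sup>2 * real n powr \<epsilon>" .
    have "real (ordered_ramsey_K3 n M) \<le> real ((2 * (i + 1) + 1)\<^sup>2 * n)"
      using ordered_ramsey_K3_le[OF M, of "i + 1"] i(2) by (simp only: of_nat_le_iff less_imp_le)
    also have "\<dots> = (real (2 * (i + 1) + 1))\<^sup>2 * real n" by simp
    also have "\<dots> \<le> ?C\<^sup>2 * real n powr \<epsilon> * real n"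
      using sq by (intro mult_right_mono) auto
    also have "\<dots> = ?C\<^sup>2 * real n powr (1 + \<epsilon>)"
      using False by (simp add: powr_add)
    finally show ?thesis .
  qed
  then show "\<exists>c. \<forall>n M. parenthesis_matching n M \<longrightarrow>
      real (ordered_ramsey_K3 n M) \<le> c * real n powr (1 + \<epsilon>)" by blast
qed

end
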